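(* Let $\mathcal{M}$ be a constrained Markov decision process with transition kernel $p$, and let $k_*$ be its minimal required budget. For every $(s,a)\in\mathcal{S}\times\mathcal{A}$, $$k_*(s,a)=\max_{s':\,p(s'\mid s,a)>0}\Big[\mathbf{1}_d(s,a,s')+\min_{a'\in\mathcal{A}}k_*(s',a')\Big],$$ where $\mathbf{1}_d(s,a,s'):=\mathbf{1}\{p(d=1\mid s,a,s')>0\}$ equals $1$ if damage has positive conditional probability given the transition $(s,a,s')$, and $0$ otherwise.
   Context: A constrained Markov decision process (CMDP) $\mathcal{M}=(\mathcal{S},\mathcal{A},p,r,d)$ has a finite state set $\mathcal{S}$, a finite action set $\mathcal{A}$, and a transition kernel $p(s',r,d\mid s,a)$ giving the joint conditional law of the next state $S_{t+1}=s'$, the reward $R_{t+1}=r\in\mathbb{R}$ and the binary damage indicator $D_{t+1}=d\in\{0,1\}$ given $S_t=s,A_t=a$; $p(s'\mid s,a)$ and $p(d\mid s,a,s')$ are the corresponding marginal and conditional probabilities. Standing assumptions: there is an absorbing termination state in which the system remains with no further reward, and it is eventually reached under any policy. The budget evolves as $K_{t+1}=K_t-D_{t+1}$. A stationary (memory) policy $\tilde\pi$ chooses $A_t$ from a distribution $\tilde\pi(\cdot\mid S_t,K_t)$ on $\mathcal{A}$ (choices at negative budgets arbitrary). For $k\in\mathbb{N}\cup\{\infty\}$ the barrier function is $$B_{\tilde\pi}(s,k,a)=\mathbb{E}_{\tilde\pi}\Big[\mathbb{I}\Big\{\sum_{\ell=t}^\infty D_{\ell+1}\le K_t\Big\}\,\Big|\,S_t=s,K_t=k,A_t=a\Big],$$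 where $\mathbb{I}\{x\}=0$ if $x$ is true and $-\infty$ otherwise; so $B_{\tilde\pi}(s,k,a)=0$ if the total future damage is at most $k$ with probability one and $-\infty$ otherwise. The optimal barrier function is $B_*(s,k,a)=\max_{\tilde\pi}B_{\tilde\pi}(s,k,a)$ over stationary memory policies. The minimal required budget is $k_*(s,a)=\min\{k\in\{0,1,2,\dots\}\cup\{\infty\}: B_*(s,k,a)=0\}$ (the value $\infty$ is allowed, with $1+\infty=\infty$). *)

theory Defs
  imports "HOL-Probability.Probability"
begin

text \<open>
  One transition produces an outcome \<open>(s', r, d)\<close>: next state, reward, damage indicator
  (\<open>d = True\<close> stands for \<open>D = 1\<close>). The reward law is an arbitrary law on the reals.
\<close>

type_synonym 's outcome = "'s \<times> real \<times> bool"

type_synonym ('s, 'a) kernel = "'s \<Rightarrow> 'a \<Rightarrow> 's outcome measure"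

definition outcome_space :: "'s outcome measure" where
  "outcome_space = count_space UNIV \<Otimes>\<^sub>M borel \<Otimes>\<^sub>M count_space UNIV"

locale transition_kernel =
  fixes p :: "('s::finite, 'a::finite) kernel"
  assumes prob_space_kernel: "prob_space (p s a)"
    and sets_kernel: "sets (p s a) = sets outcome_space"

definition trans_prob :: "('s, 'a) kernel \<Rightarrow> 's \<Rightarrow> 'a \<Rightarrow> 's \<Rightarrow> real" where
  "trans_prob p s a s' = \<P>(x in p s a. fst x = s')"

definition damage_prob :: "('s, 'a) kernel \<Rightarrow> 's \<Rightarrow> 'a \<Rightarrow> 's \<Rightarrow> real" where
  "damage_prob p s a s' = \<P>(x in p s a. snd (snd x) \<bar> fst x = s')"

definition damage_indicator :: "('s, 'a) kernel \<Rightarrow> 's \<Rightarrow> 'a \<Rightarrow> 's \<Rightarrow> enat" where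
  "damage_indicator p s a s' = of_bool (damage_prob p s a s' > 0)"

text \<open>
  Running budgets \<open>K\<^sub>t\<close>. They start in \<open>enat\<close> but may become negative.
\<close>

datatype budget = Finite int | Infinite

instance budget :: countable
  by countable_datatype

definition initial_budget :: "enat \<Rightarrow> budget" where
  "initial_budget k = (case k of enat j \<Rightarrow> Finite (int j) | \<infinity> \<Rightarrow> Infinite)"

fun spend :: "budget \<Rightarrow> bool \<Rightarrow> budget" where
  "spend (Finite j) d = Finite (j - of_bool d)"
| "spend Infinite d = Infinite"

type_synonym ('s, 'a) policy = "'s \<Rightarrow> budget \<Rightarrow> 'a pmf"

text \<open>
  The record made by one step: the outcome \<open>(S\<^sub>t\<^sub>+\<^sub>1, R\<^sub>t\<^sub>+\<^sub>1, D\<^sub>t\<^sub>+\<^sub>1)\<close>, the new budget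
  \<open>K\<^sub>t\<^sub>+\<^sub>1\<close> and the next action \<open>A\<^sub>t\<^sub>+\<^sub>1\<close>.
\<close>

type_synonym ('s, 'a) step = "'s outcome \<times> budget \<times> 'a"

definition step_space :: "('s, 'a) step measure" where
  "step_space = outcome_space \<Otimes>\<^sub>M count_space UNIV \<Otimes>\<^sub>M count_space UNIV"

definition step_kernel ::
    "('s, 'a) kernel \<Rightarrow> ('s, 'a) policy \<Rightarrow> 's \<Rightarrow> budget \<Rightarrow> 'a \<Rightarrow> ('s, 'a) step measure" where
  "step_kernel p \<pi> s k a =
     p s a \<bind> (\<lambda>(s', r, d). distr (measure_pmf (\<pi> s' (spend k d))) step_space
       (\<lambda>a'. ((s', r, d), spend k d, a')))"

text \<open>
  The law of the steps following time \<open>t\<close>, conditionally on \<open>S\<^sub>t = s, K\<^sub>t = k, A\<^sub>t = a\<close>: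
  coordinate \<open>n\<close> of a trajectory is the step from time \<open>t + n\<close> to time \<open>t + n + 1\<close>. By the
  Markov property this does not depend on \<open>t\<close>, and it is well defined whether or not the
  conditioning event can occur.
\<close>

definition history_kernel ::
    "('s, 'a) kernel \<Rightarrow> ('s, 'a) policy \<Rightarrow> 's \<Rightarrow> enat \<Rightarrow> 'a \<Rightarrow>
     nat \<Rightarrow> (nat \<Rightarrow> ('s, 'a) step) \<Rightarrow> ('s, 'a) step measure" where
  "history_kernel p \<pi> s k a n \<omega> =
     (case n of
        0 \<Rightarrow> step_kernel p \<pi> s (initial_budget k) a
      | Suc m \<Rightarrow> (case \<omega> m of ((s', r, d), k', a') \<Rightarrow> step_kernel p \<pi> s' k' a'))"

definition trajectory_law ::
    "('s, 'a) kernel \<Rightarrow> ('s, 'a) policy \<Rightarrow> 's \<Rightarrow> enat \<Rightarrow> 'a \<Rightarrow> (nat \<Rightarrow> ('s, 'a) step) measure" where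
  "trajectory_law p \<pi> s k a =
     projective_family.lim UNIV
       (Ionescu_Tulcea.CI (history_kernel p \<pi> s k a) (\<lambda>_. step_space)) (\<lambda>_. step_space)"

definition next_state :: "(nat \<Rightarrow> ('s, 'a) step) \<Rightarrow> nat \<Rightarrow> 's" where
  "next_state \<omega> n = fst (fst (\<omega> n))"

definition damage :: "(nat \<Rightarrow> ('s, 'a) step) \<Rightarrow> nat \<Rightarrow> bool" where
  "damage \<omega> n = snd (snd (fst (\<omega> n)))"

definition total_damage :: "(nat \<Rightarrow> ('s, 'a) step) \<Rightarrow> ereal" where
  "total_damage \<omega> = (\<Sum>n. of_bool (damage \<omega> n))"

locale cmdp = transition_kernel p for p :: "('s::finite, 'a::finite) kernel" +
  assumes reaches_terminal:
    "\<exists>z. (\<forall>a. AE x in p z a. fst x = z \<and> fst (snd x) = 0) \<and>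
         (\<forall>\<pi> s k a. AE \<omega> in trajectory_law p \<pi> s k a. \<exists>n. next_state \<omega> n = z)"

definition barrier_value :: "bool \<Rightarrow> ereal" where
  "barrier_value b = (if b then 0 else - \<infinity>)"

text \<open>
  The expectation of the nonpositive extended real variable \<open>X\<close> is minus the nonnegative
  integral of \<open>- X\<close>.
\<close>

definition barrier :: "('s, 'a) kernel \<Rightarrow> ('s, 'a) policy \<Rightarrow> 's \<Rightarrow> enat \<Rightarrow> 'a \<Rightarrow> ereal" where
  "barrier p \<pi> s k a =
     - enn2ereal (\<integral>\<^sup>+ \<omega>. e2ennreal (- barrier_value (total_damage \<omega> \<le> ereal_of_enat k))
                     \<partial>trajectory_law p \<pi> s k a)"

definition opt_barrier :: "('s, 'a) kernel \<Rightarrow> 's \<Rightarrow> enat \<Rightarrow> 'a \<Rightarrow> ereal" where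
  "opt_barrier p s k a = (MAX \<pi>. barrier p \<pi> s k a)"

definition min_budget :: "('s, 'a) kernel \<Rightarrow> 's \<Rightarrow> 'a \<Rightarrow> enat" where
  "min_budget p s a = (LEAST k. opt_barrier p s k a = 0)"


subsection \<open>Well-definedness\<close>

lemma space_outcome_space [simp]: "space outcome_space = UNIV"
  by (simp add: outcome_space_def space_pair_measure)

lemma space_step_space [simp]: "space step_space = UNIV"
  by (simp add: step_space_def space_pair_measure)

context transition_kernel
begin

lemma space_kernel [simp]: "space (p s a) = UNIV"
  using sets_eq_imp_space_eq[OF sets_kernel[of s a]] by simp

lemma measurable_policy_step:
  "(\<lambda>(s', r, d). distr (measure_pmf (\<pi> s' (spend k d))) step_space
      (\<lambda>a'. ((s', r, d), spend k d, a'))) \<in> measurable (p s a) (prob_algebra step_space)"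
proof -
  have "(\<lambda>x. distr (measure_pmf (\<pi> (fst x) (spend k (snd (snd x))))) step_space
      (\<lambda>a'. ((x, spend k (snd (snd x)), a')))) \<in> measurable outcome_space (prob_algebra step_space)"
    (is "?f \<in> _")
  proof (rule measurable_compose_countable'[where
        f = "\<lambda>i x. distr (measure_pmf (\<pi> (fst i) (spend k (snd i)))) step_space
               (\<lambda>a'. ((x, spend k (snd i), a')))"
        and g = "\<lambda>x. (fst x, snd (snd x))" and I = UNIV, simplified fst_conv snd_conv])
    fix i :: "'s \<times> bool"
    show "(\<lambda>x. distr (measure_pmf (\<pi> (fst i) (spend k (snd i)))) step_space
        (\<lambda>a'. ((x, spend k (snd i), a')))) \<in> measurable outcome_space (prob_algebra step_space)"
      by (rule measurable_distr_prob_space2[where M = "count_space UNIV"])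
         (auto simp: step_space_def space_prob_algebra prob_space_measure_pmf
               intro!: measurable_const)
  next
    have "(\<lambda>x. (fst x, snd (snd x)))
        \<in> measurable outcome_space (count_space (UNIV :: 's set) \<Otimes>\<^sub>M count_space (UNIV :: bool set))"
      unfolding outcome_space_def
      by (intro measurable_Pair measurable_compose[OF measurable_snd measurable_snd] measurable_fst)
    then show "(\<lambda>x. (fst x, snd (snd x)))
        \<in> measurable outcome_space (count_space (UNIV :: ('s \<times> bool) set))"
      by (simp add: pair_measure_countable)
  qed simp
  also have "?f = (\<lambda>(s', r, d). distr (measure_pmf (\<pi> s' (spend k d))) step_space
      (\<lambda>a'. ((s', r, d), spend k d, a')))"
    by auto
  finally show ?thesis
    by (simp add: measurable_cong_sets[OF sets_kernel refl])
qed

lemma step_kernel_prob: "step_kernel p \<pi> s k a \<in> space (prob_algebra step_space)"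
proof -
  have "p s a \<in> space (prob_algebra (p s a))"
    by (simp add: space_prob_algebra prob_space_kernel)
  from measurable_const[OF this, of "count_space UNIV"]
  have *: "(\<lambda>_::unit. p s a) \<in> measurable (count_space UNIV) (prob_algebra (p s a))" .
  from measurable_bind_prob_space[OF * measurable_policy_step[of \<pi> k s a]]
  show ?thesis
    unfolding step_kernel_def by (auto dest: measurable_space)
qed

sublocale trajectory: Ionescu_Tulcea "history_kernel p \<pi> s k a" "\<lambda>_. step_space" for \<pi> s k a
proof (rule Ionescu_Tulcea.intro)
  fix n
  show "history_kernel p \<pi> s k a n \<in> measurable (PiM {0..<n} (\<lambda>_. step_space)) (subprob_algebra step_space)"
  proof (cases n)
    case 0
    then show ?thesis
      using step_kernel_prob[of \<pi> s "initial_budget k" a]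
      by (auto simp: history_kernel_def[abs_def] space_prob_algebra space_subprob_algebra
          prob_space_imp_subprob_space)
  next
    case (Suc m)
    have "(\<lambda>x. step_kernel p \<pi> (fst (fst x)) (fst (snd x)) (snd (snd x)))
        \<in> measurable step_space (prob_algebra step_space)"
    proof (rule measurable_compose_countable'[where
          f = "\<lambda>i _. step_kernel p \<pi> (fst i) (fst (snd i)) (snd (snd i))"
          and g = "\<lambda>x. (fst (fst x), fst (snd x), snd (snd x))" and I = UNIV,
          simplified fst_conv snd_conv])
      fix i :: "'s \<times> budget \<times> 'a"
      show "(\<lambda>_. step_kernel p \<pi> (fst i) (fst (snd i)) (snd (snd i)))
          \<in> measurable step_space (prob_algebra step_space)"
        by (intro measurable_const step_kernel_prob)
    next
      have "(\<lambda>x. (fst (fst x), fst (snd x), snd (snd x)))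
          \<in> measurable step_space (count_space (UNIV :: 's set) \<Otimes>\<^sub>M
               (count_space (UNIV :: budget set) \<Otimes>\<^sub>M count_space (UNIV :: 'a set)))"
        unfolding step_space_def outcome_space_def
        by (intro measurable_Pair measurable_compose[OF measurable_fst measurable_fst]
            measurable_compose[OF measurable_snd measurable_fst]
            measurable_compose[OF measurable_snd measurable_snd])
      then show "(\<lambda>x. (fst (fst x), fst (snd x), snd (snd x)))
          \<in> measurable step_space (count_space (UNIV :: ('s \<times> budget \<times> 'a) set))"
        by (simp add: pair_measure_countable)
    qed simp
    from measurable_prob_algebraD[OF this]
    have [measurable]: "(\<lambda>x. step_kernel p \<pi> (fst (fst x)) (fst (snd x)) (snd (snd x)))
        \<in> measurable step_space (subprob_algebra step_space)" .
    have "(\<lambda>\<omega>. step_kernel p \<pi> (fst (fst (\<omega> m))) (fst (snd (\<omega> m))) (snd (snd (\<omega> m))))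
        \<in> measurable (PiM {0..<n} (\<lambda>_. step_space)) (subprob_algebra step_space)"
      by (rule measurable_compose[OF measurable_component_singleton]) (use Suc in auto)
    then show ?thesis
      by (simp add: Suc history_kernel_def[abs_def] case_prod_beta)
  qed
next
  fix n \<omega>
  show "prob_space (history_kernel p \<pi> s k a n \<omega>)"
    using step_kernel_prob by (auto simp: history_kernel_def space_prob_algebra
        split: nat.split prod.split)
qed

lemma prob_space_trajectory_law: "prob_space (trajectory_law p \<pi> s k a)"
proof
  let ?M = "\<lambda>_::nat. (step_space :: ('s, 'a) step measure)"
  have "space (PiM UNIV ?M) = prod_emb UNIV ?M {} (space (PiM {} ?M))"
    by (auto simp: prod_emb_def space_PiM)
  then have "emeasure (trajectory_law p \<pi> s k a) (space (PiM UNIV ?M)) =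
      emeasure (trajectory.CI \<pi> s k a {}) (space (PiM {} ?M))"
    unfolding trajectory_law_def by (metis trajectory.lim finite.emptyI sets.top)
  also have "\<dots> = 1"
    using prob_space.emeasure_space_1[OF trajectory.PF.prob_space_P[of "{}" \<pi> s k a]]
    by (simp add: trajectory.CI_def)
  finally show "emeasure (trajectory_law p \<pi> s k a) (space (trajectory_law p \<pi> s k a)) = 1"
    by (simp add: trajectory_law_def)
qed

lemma sets_trajectory_law: "sets (trajectory_law p \<pi> s k a) = sets (PiM UNIV (\<lambda>_. step_space))"
  unfolding trajectory_law_def by (rule trajectory.PF.sets_lim)

lemma barrier_eq:
  "barrier p \<pi> s k a =
     (if AE \<omega> in trajectory_law p \<pi> s k a. total_damage \<omega> \<le> ereal_of_enat k then 0 else - \<infinity>)"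
proof -
  let ?T = "trajectory_law p \<pi> s k a"
  interpret prob_space ?T
    by (rule prob_space_trajectory_law)
  have [measurable]: "total_damage \<in> borel_measurable ?T"
  proof -
    have "(\<lambda>x. snd (snd (fst x))) \<in> measurable step_space (count_space UNIV)"
      unfolding step_space_def outcome_space_def by measurable
    then have [measurable]: "Measurable.pred (PiM UNIV (\<lambda>_. step_space)) (\<lambda>\<omega>. damage \<omega> n)" for n
      unfolding damage_def
      by (rule measurable_compose[OF measurable_component_singleton[OF UNIV_I]])
    have "total_damage \<in> borel_measurable (PiM UNIV (\<lambda>_. step_space))"
      unfolding total_damage_def of_bool_def by measurable
    then show ?thesis
      by (simp add: measurable_cong_sets[OF sets_trajectory_law refl])
  qed
  define E where "E = {\<omega> \<in> space ?T. \<not> total_damage \<omega> \<le> ereal_of_enat k}"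
  have [measurable]: "E \<in> sets ?T"
    unfolding E_def by measurable
  have "(\<integral>\<^sup>+ \<omega>. e2ennreal (- barrier_value (total_damage \<omega> \<le> ereal_of_enat k)) \<partial>?T)
      = (\<integral>\<^sup>+ \<omega>. \<infinity> * indicator E \<omega> \<partial>?T)"
    by (intro nn_integral_cong)
       (auto simp: barrier_value_def E_def e2ennreal_infty split: split_indicator)
  also have "\<dots> = \<infinity> * emeasure ?T E"
    by (simp add: nn_integral_cmult_indicator)
  finally have "barrier p \<pi> s k a = - enn2ereal (\<infinity> * emeasure ?T E)"
    by (simp add: barrier_def)
  moreover have "(AE \<omega> in ?T. total_damage \<omega> \<le> ereal_of_enat k) \<longleftrightarrow> emeasure ?T E = 0"
    by (subst AE_iff_measurable[of E]) (auto simp: E_def)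
  ultimately show ?thesis
    by (auto simp: ennreal_top_mult zero_ennreal.rep_eq)
qed

lemma finite_range_barrier: "finite (range (\<lambda>\<pi>. barrier p \<pi> s k a))"
  by (rule finite_subset[of _ "{0, - \<infinity>}"]) (auto simp: barrier_eq)

lemma opt_barrier_infinity: "opt_barrier p s \<infinity> a = 0"
  by (simp add: opt_barrier_def barrier_eq)

lemma opt_barrier_min_budget: "opt_barrier p s (min_budget p s a) a = 0"
  unfolding min_budget_def by (rule LeastI) (rule opt_barrier_infinity)

end

end

theory Submission
  imports Defs
begin

text \<open>
  All random choices that matter range over countable sets, so the barrier is decided by the
  supports of the kernel and of the policy alone: it vanishes iff no configuration (state, budget,
  action) with a negative budget is reached with positive probability. Hence some policy has
  barrier \<open>0\<close> iff the configuration lies in the greatest set from which every possible transition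
  is affordable and some next action stays in the set, and a policy choosing such actions is
  stationary. This set is upward closed in the budget, \<open>k\<^sub>*\<close> is its lower boundary, and unfolding
  its fixed point equation once gives the recursion.
\<close>

section \<open>Almost sure statements about finite prefixes of an Ionescu-Tulcea limit\<close>

context Ionescu_Tulcea
begin

lemma CI_atLeast0LessThan: "CI {0..<n} = C 0 n (\<lambda>_. undefined)"
proof -
  have "up_to {0..<n} = n"
  proof (rule le_antisym)
    show "up_to {0..<n} \<le> n"
      by (simp add: up_to_iff)
    show "n \<le> up_to {0..<n}"
      using up_to_less[of "{0..<n}" "up_to {0..<n}"] by (intro leI) auto
  qed
  then show ?thesis
    using distr_C[of n n "\<lambda>_. undefined" 0] by (simp add: CI_def)
qed

text \<open>Restriction to the first \<open>n\<close> coordinates pushes the limit measure forward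
  to the \<open>n\<close>-step law, so a property of the prefix can be checked under either
  measure.\<close>

lemma AE_lim_restrict_iff:
  assumes Q: "Measurable.pred (PiM {0..<n} M) Q"
  shows "(AE \<omega> in PF.lim. Q (restrict \<omega> {0..<n})) \<longleftrightarrow> (AE x in C 0 n (\<lambda>_. undefined). Q x)"
proof -
  have "(AE x in distr PF.lim (PiM {0..<n} M) (\<lambda>\<omega>. restrict \<omega> {0..<n}). Q x) \<longleftrightarrow>
      (AE \<omega> in PF.lim. Q (restrict \<omega> {0..<n}))"
    by (rule AE_distr_iff)
       (use Q in \<open>auto simp: measurable_cong_sets[OF PF.sets_lim refl]
          intro!: measurable_restrict measurable_component_singleton\<close>)
  then show ?thesis
    unfolding distr_lim[OF finite_atLeastLessThan] CI_atLeast0LessThan by (rule sym)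
qed

text \<open>The inner condition says that a kernel gives mass zero to a fixed measurable set. Its
  measurability allows the passage from the \<open>n\<close>-step law back to the limit
  measure.\<close>

lemma pred_AE_eP:
  assumes Q[measurable]: "Measurable.pred (PiM {0..<Suc n} M) Q"
  shows "Measurable.pred (PiM {0..<n} M) (\<lambda>x. AE y in eP n x. Q y)"
proof -
  have "(\<lambda>x. emeasure (eP n x) {y \<in> space (PiM {0..<Suc n} M). \<not> Q y})
      \<in> borel_measurable (PiM {0..<n} M)"
    by (rule measurable_emeasure_kernel[OF measurable_eP]) measurable
  then have "Measurable.pred (PiM {0..<n} M)
      (\<lambda>x. emeasure (eP n x) {y \<in> space (PiM {0..<Suc n} M). \<not> Q y} = 0)"
    by measurable
  moreover have "(AE y in eP n x. Q y) \<longleftrightarrow>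
      emeasure (eP n x) {y \<in> space (PiM {0..<Suc n} M). \<not> Q y} = 0"
    if "x \<in> space (PiM {0..<n} M)" for x
    by (rule AE_iff_measurable) (use that in \<open>auto simp: sets_eP space_eP\<close>)
  ultimately show ?thesis
    by (simp cong: measurable_cong)
qed

text \<open>The law of \<open>n + 1\<close> steps is the \<open>n\<close>-step law bound to
  \<open>eP n\<close>. Going down to the finite laws, splitting the bind and coming back up keeps
  both sides under the single measure \<open>PF.lim\<close>, which suits induction on time.\<close>

lemma AE_lim_Suc_iff:
  assumes Q[measurable]: "Measurable.pred (PiM {0..<Suc n} M) Q"
  shows "(AE \<omega> in PF.lim. Q (restrict \<omega> {0..<Suc n})) \<longleftrightarrow>
    (AE \<omega> in PF.lim. AE y in P n (restrict \<omega> {0..<n}). Q ((restrict \<omega> {0..<n})(n := y)))"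
proof -
  have "(AE \<omega> in PF.lim. Q (restrict \<omega> {0..<Suc n})) \<longleftrightarrow>
      (AE x in C 0 n (\<lambda>_. undefined) \<bind> eP n. Q x)"
    unfolding AE_lim_restrict_iff[OF Q] C.simps add_0 ..
  also have "\<dots> \<longleftrightarrow> (AE x in C 0 n (\<lambda>_. undefined). AE y in eP n x. Q y)"
    by (rule AE_bind[OF _ Q])
       (simp add: measurable_cong_sets[OF sets_C refl, of "\<lambda>_. undefined" 0 n, simplified])
  also have "\<dots> \<longleftrightarrow> (AE \<omega> in PF.lim. AE y in eP n (restrict \<omega> {0..<n}). Q y)"
    by (rule AE_lim_restrict_iff[OF pred_AE_eP[OF Q], symmetric])
  also have "\<dots> \<longleftrightarrow>
      (AE \<omega> in PF.lim. AE y in P n (restrict \<omega> {0..<n}). Q ((restrict \<omega> {0..<n})(n := y)))"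
  proof (rule AE_cong)
    fix \<omega> assume "\<omega> \<in> space PF.lim"
    then have x: "restrict \<omega> {0..<n} \<in> space (PiM {0..<n} M)"
      by (auto simp: space_PiM)
    \<comment> \<open>\<open>eP n\<close> is the image of \<open>P n\<close> under appending
      coordinate \<open>n\<close>; measurability of this map lets the image measure be
      removed.\<close>
    have "fun_upd (restrict \<omega> {0..<n}) n \<in> measurable (P n (restrict \<omega> {0..<n})) (PiM {0..<Suc n} M)"
      by (rule measurable_fun_upd[where J="{0..<n}"])
         (use x in \<open>auto simp: measurable_cong_sets[OF sets_P[OF x] refl]\<close>)
    then show "(AE y in eP n (restrict \<omega> {0..<n}). Q y) \<longleftrightarrow>
        (AE y in P n (restrict \<omega> {0..<n}). Q ((restrict \<omega> {0..<n})(n := y)))"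
      unfolding eP_def by (rule AE_distr_iff) measurable
  qed
  finally show ?thesis .
qed

end

section \<open>Possible transitions, viability and configurations\<close>

definition transition_possible :: "('s, 'a) kernel \<Rightarrow> 's \<Rightarrow> 'a \<Rightarrow> 's \<Rightarrow> bool \<Rightarrow> bool" where
  "transition_possible p s a s' d \<longleftrightarrow> \<not> (AE x in p s a. \<not> (fst x = s' \<and> snd (snd x) = d))"

definition viable_under ::
    "('s, 'a) kernel \<Rightarrow> ('s, 'a) policy \<Rightarrow> 's \<Rightarrow> enat \<Rightarrow> 'a \<Rightarrow> bool" where
  "viable_under p \<pi> s k a \<longleftrightarrow>
     (AE \<omega> in trajectory_law p \<pi> s k a. total_damage \<omega> \<le> ereal_of_enat k)"

text \<open>A game against chance: every possible transition must be affordable, and some reply must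
  remain safe. The greatest fixed point is essential: each pair of a transition kernel has a
  possible transition, so the least one would be empty. The bound \<open>of_bool d \<le> k\<close>
  guards the truncated subtraction on \<open>enat\<close>.\<close>

coinductive viable :: "('s, 'a) kernel \<Rightarrow> 's \<Rightarrow> enat \<Rightarrow> 'a \<Rightarrow> bool" for p where
  viableI: "(\<And>s' d. transition_possible p s a s' d \<Longrightarrow>
      of_bool d \<le> k \<and> (\<exists>a'. viable p s' (k - of_bool d) a')) \<Longrightarrow> viable p s k a"

text \<open>Coordinate \<open>m\<close> of a trajectory records the situation after step
  \<open>m\<close>, hence the shift by one. Adding the initial data at index 0 makes every step,
  including the first, lead from index \<open>n\<close> to \<open>Suc n\<close>.\<close>

definition configuration ::
    "'s \<Rightarrow> enat \<Rightarrow> 'a \<Rightarrow> (nat \<Rightarrow> ('s, 'a) step) \<Rightarrow> nat \<Rightarrow> 's \<times> budget \<times> 'a" where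
  "configuration s k a \<omega> n =
     (case n of 0 \<Rightarrow> (s, initial_budget k, a) | Suc m \<Rightarrow> (fst (fst (\<omega> m)), snd (\<omega> m)))"

lemma configuration_0 [simp]: "configuration s k a \<omega> 0 = (s, initial_budget k, a)"
  by (simp add: configuration_def)

lemma configuration_Suc [simp]: "configuration s k a \<omega> (Suc n) = (fst (fst (\<omega> n)), snd (\<omega> n))"
  by (simp add: configuration_def)

section \<open>Almost sure statements reduced to supports\<close>

context transition_kernel
begin

lemma measurable_configuration_damage:
  "(\<lambda>x. (fst (fst x), snd x, snd (snd (fst x))))
     \<in> measurable step_space (count_space (UNIV :: ('s \<times> (budget \<times> 'a) \<times> bool) set))"
proof -
  have "(\<lambda>x. (fst (fst x), snd x, snd (snd (fst x))))
      \<in> measurable step_space (count_space (UNIV :: 's set) \<Otimes>\<^sub>M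
           ((count_space (UNIV :: budget set) \<Otimes>\<^sub>M count_space (UNIV :: 'a set)) \<Otimes>\<^sub>M
             count_space (UNIV :: bool set)))"
    unfolding step_space_def outcome_space_def by measurable
  then show ?thesis
    by (simp add: pair_measure_countable)
qed

text \<open>Leaving out the real-valued reward makes the predicate factor through a countable
  discrete space, so any \<open>\<phi>\<close> is measurable.\<close>

lemma pred_step_space:
  "Measurable.pred step_space
     (\<lambda>x :: ('s, 'a) step. \<phi> (fst (fst x)) (snd x) (snd (snd (fst x))))"
  using measurable_compose[OF measurable_configuration_damage,
      of "\<lambda>(s', c, d). \<phi> s' c d" "count_space UNIV"]
  by simp

lemma measurable_outcome:
  "(\<lambda>x. (fst x, snd (snd x))) \<in> measurable (p s a) (count_space (UNIV :: ('s \<times> bool) set))"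
proof -
  have "(\<lambda>x. (fst x, snd (snd x)))
      \<in> measurable outcome_space (count_space (UNIV :: 's set) \<Otimes>\<^sub>M count_space (UNIV :: bool set))"
    unfolding outcome_space_def by measurable
  then show ?thesis
    by (simp add: pair_measure_countable measurable_cong_sets[OF sets_kernel refl])
qed

lemma pred_outcome: "Measurable.pred (p s a) (\<lambda>x. \<phi> (fst x) (snd (snd x)))"
  using measurable_compose[OF measurable_outcome,
      of "\<lambda>(s', d). \<phi> s' d" "count_space UNIV"]
  by simp

text \<open>The exceptional set is a countable union over the pairs violating \<open>\<phi>\<close>,
  and such a union is null iff each piece is.\<close>

lemma AE_kernel_iff:
  "(AE x in p s a. \<phi> (fst x) (snd (snd x))) \<longleftrightarrow>
     (\<forall>s' d. transition_possible p s a s' d \<longrightarrow> \<phi> s' d)" (is "?L \<longleftrightarrow> ?R")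
proof -
  have "?L \<longleftrightarrow> (AE x in p s a. \<forall>s' d. \<not> \<phi> s' d \<longrightarrow> \<not> (fst x = s' \<and> snd (snd x) = d))"
    by (intro AE_cong) blast
  also have "\<dots> \<longleftrightarrow> ?R"
    unfolding transition_possible_def AE_all_countable
    by auto
  finally show ?thesis .
qed

text \<open>The two layers of the bind are resolved in turn: the policy by the support of its
  \<open>pmf\<close>, the kernel by its possible transitions.\<close>

lemma AE_step_kernel_iff:
  "(AE x in step_kernel p \<pi> s b a. \<phi> (fst (fst x)) (snd x) (snd (snd (fst x)))) \<longleftrightarrow>
     (\<forall>s' d a'. transition_possible p s a s' d \<longrightarrow> a' \<in> set_pmf (\<pi> s' (spend b d)) \<longrightarrow>
        \<phi> s' (spend b d, a') d)"
proof -
  have "(AE x in step_kernel p \<pi> s b a. \<phi> (fst (fst x)) (snd x) (snd (snd (fst x)))) \<longleftrightarrow>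
      (AE x in p s a. AE y in (\<lambda>(s', r, d). distr (measure_pmf (\<pi> s' (spend b d))) step_space
       (\<lambda>a'. ((s', r, d), spend b d, a'))) x. \<phi> (fst (fst y)) (snd y) (snd (snd (fst y))))"
    unfolding step_kernel_def
    by (rule AE_bind[OF measurable_prob_algebraD[OF measurable_policy_step] pred_step_space])
  also have "\<dots> \<longleftrightarrow> (AE x in p s a. \<forall>a' \<in> set_pmf (\<pi> (fst x) (spend b (snd (snd x)))).
      \<phi> (fst x) (spend b (snd (snd x)), a') (snd (snd x)))"
  proof (rule AE_cong)
    fix x :: "'s outcome"
    obtain s' r d where x: "x = (s', r, d)"
      by (cases x)
    have "(AE y in distr (measure_pmf (\<pi> s' (spend b d))) step_space
         (\<lambda>a'. ((s', r, d), spend b d, a')). \<phi> (fst (fst y)) (snd y) (snd (snd (fst y)))) \<longleftrightarrow>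
       (AE a' in \<pi> s' (spend b d). \<phi> s' (spend b d, a') d)"
      by (subst AE_distr_iff) (use pred_step_space[of \<phi>] in \<open>auto simp: pred_def\<close>)
    then show "(AE y in (\<lambda>(s', r, d). distr (measure_pmf (\<pi> s' (spend b d))) step_space
       (\<lambda>a'. ((s', r, d), spend b d, a'))) x. \<phi> (fst (fst y)) (snd y) (snd (snd (fst y)))) \<longleftrightarrow>
       (\<forall>a' \<in> set_pmf (\<pi> (fst x) (spend b (snd (snd x)))).
      \<phi> (fst x) (spend b (snd (snd x)), a') (snd (snd x)))"
      unfolding x prod.case fst_conv snd_conv AE_measure_pmf_iff .
  qed
  also have "\<dots> \<longleftrightarrow> (\<forall>s' d. transition_possible p s a s' d \<longrightarrow>
      (\<forall>a' \<in> set_pmf (\<pi> s' (spend b d)). \<phi> s' (spend b d, a') d))"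
    by (rule AE_kernel_iff)
  finally show ?thesis
    by blast
qed

text \<open>The Markov property at the level of supports. Letting \<open>\<phi>\<close> see both
  configurations and the damage makes one statement serve budget bookkeeping, reachability and
  invariance.\<close>

lemma AE_trajectory_law_step_iff:
  "(AE \<omega> in trajectory_law p \<pi> s k a.
      \<phi> (configuration s k a \<omega> n) (configuration s k a \<omega> (Suc n)) (damage \<omega> n)) \<longleftrightarrow>
   (AE \<omega> in trajectory_law p \<pi> s k a. case configuration s k a \<omega> n of (s', b, a') \<Rightarrow>
      \<forall>s'' d a''. transition_possible p s' a' s'' d \<longrightarrow> a'' \<in> set_pmf (\<pi> s'' (spend b d)) \<longrightarrow>
        \<phi> (s', b, a') (s'', spend b d, a'') d)"
proof -
  let ?c = "\<lambda>\<omega>. configuration s k a \<omega> n"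
  let ?Q = "\<lambda>\<omega>. \<phi> (?c \<omega>) (configuration s k a \<omega> (Suc n)) (damage \<omega> n)"
  have c: "?c \<in> measurable (PiM {0..<Suc n} (\<lambda>_. step_space)) (count_space UNIV)"
  proof (cases n)
    case (Suc m)
    have "(\<lambda>x :: ('s, 'a) step. (fst (fst x), snd x)) \<in> measurable step_space (count_space UNIV)"
      using measurable_compose[OF measurable_configuration_damage,
        of "\<lambda>(s', c, d). (s', c)" "count_space UNIV"] by simp
    from measurable_compose[OF measurable_component_singleton[of m "{0..<Suc n}"] this]
    show ?thesis
      unfolding Suc configuration_Suc by simp
  qed simp
  have "Measurable.pred (PiM {0..<Suc n} (\<lambda>_. step_space)) ?Q"
    unfolding configuration_Suc damage_def
  \<comment> \<open>The current configuration takes countably many values, so it may be frozen at a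
    value \<open>i\<close>.\<close>
  proof (rule measurable_compose_countable'[where I = UNIV and g = ?c, OF _ c])
    fix i :: "'s \<times> budget \<times> 'a"
    show "Measurable.pred (PiM {0..<Suc n} (\<lambda>_. step_space))
        (\<lambda>\<omega>. \<phi> i (fst (fst (\<omega> n)), snd (\<omega> n)) (snd (snd (fst (\<omega> n)))))"
      using measurable_compose[OF measurable_component_singleton[of n "{0..<Suc n}"]
            pred_step_space[of "\<lambda>s' c d. \<phi> i (s', c) d"]] by simp
  qed simp
  from trajectory.AE_lim_Suc_iff[OF this, of \<pi> s k a]
  have "(AE \<omega> in trajectory_law p \<pi> s k a. ?Q (restrict \<omega> {0..<Suc n})) \<longleftrightarrow>
      (AE \<omega> in trajectory_law p \<pi> s k a.
         AE y in history_kernel p \<pi> s k a n (restrict \<omega> {0..<n}). ?Q ((restrict \<omega> {0..<n})(n := y)))"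
    unfolding trajectory_law_def .
  \<comment> \<open>Only coordinate \<open>n\<close> and, for positive \<open>n\<close>, its
    predecessor are read, so the restrictions are invisible.\<close>
  moreover have "?Q (restrict \<omega> {0..<Suc n}) \<longleftrightarrow> ?Q \<omega>"
    and "?Q ((restrict \<omega> {0..<n})(n := y)) \<longleftrightarrow> \<phi> (?c \<omega>) (fst (fst y), snd y) (snd (snd (fst y)))"
    and "history_kernel p \<pi> s k a n (restrict \<omega> {0..<n}) =
      step_kernel p \<pi> (fst (?c \<omega>)) (fst (snd (?c \<omega>))) (snd (snd (?c \<omega>)))" for \<omega> y
    by (cases n; simp add: history_kernel_def damage_def case_prod_beta)+
  ultimately have "(AE \<omega> in trajectory_law p \<pi> s k a. ?Q \<omega>) \<longleftrightarrow>
    (AE \<omega> in trajectory_law p \<pi> s k a.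
       AE y in step_kernel p \<pi> (fst (?c \<omega>)) (fst (snd (?c \<omega>))) (snd (snd (?c \<omega>))).
        \<phi> (?c \<omega>) (fst (fst y), snd y) (snd (snd (fst y))))"
    by (simp only:)
  also have "\<dots> \<longleftrightarrow> (AE \<omega> in trajectory_law p \<pi> s k a. case ?c \<omega> of (s', b, a') \<Rightarrow>
      \<forall>s'' d a''. transition_possible p s' a' s'' d \<longrightarrow> a'' \<in> set_pmf (\<pi> s'' (spend b d)) \<longrightarrow>
        \<phi> (s', b, a') (s'', spend b d, a'') d)"
    unfolding AE_step_kernel_iff[of "\<lambda>s' c d. \<phi> _ (s', c) d"]
    by (simp only: case_prod_beta prod.collapse)
  finally show ?thesis .
qed

text \<open>The trajectory space also contains sequences whose recorded budgets contradict the
  recorded damages; these form a null set.\<close>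

lemma AE_spend:
  "AE \<omega> in trajectory_law p \<pi> s k a. \<forall>n. fst (snd (configuration s k a \<omega> (Suc n))) =
     spend (fst (snd (configuration s k a \<omega> n))) (damage \<omega> n)"
proof (unfold AE_all_countable, rule allI)
  show "AE \<omega> in trajectory_law p \<pi> s k a. fst (snd (configuration s k a \<omega> (Suc n))) =
     spend (fst (snd (configuration s k a \<omega> n))) (damage \<omega> n)" for n
    using AE_trajectory_law_step_iff[where s = s and k = k and a = a and \<pi> = \<pi> and n = n
        and \<phi> = "\<lambda>c c' d. fst (snd c') = spend (fst (snd c)) d"]
    by (auto simp: split_beta)
qed

end

section \<open>Budgets and total damage\<close>

lemma initial_budget_eq_iff [simp]: "initial_budget k = initial_budget k' \<longleftrightarrow> k = k'"
  by (auto simp: initial_budget_def split: enat.splits)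

lemma spend_initial_budget:
  "of_bool d \<le> k \<Longrightarrow> spend (initial_budget k) d = initial_budget (k - of_bool d)"
  by (cases k; cases d) (auto simp: initial_budget_def one_enat_def of_nat_diff)

text \<open>The range of \<open>initial_budget\<close> serves throughout as the set of nonnegative
  budgets.\<close>

lemma spend_initial_budget_in_range_iff:
  "spend (initial_budget k) d \<in> range initial_budget \<longleftrightarrow> of_bool d \<le> k"
proof
  assume "spend (initial_budget k) d \<in> range initial_budget"
  then show "of_bool d \<le> k"
    by (cases k; cases d) (auto simp: initial_budget_def one_enat_def split: enat.splits)
qed (auto simp: spend_initial_budget)

lemma Finite_in_range_initial_budget_iff: "Finite i \<in> range initial_budget \<longleftrightarrow> 0 \<le> i"
proof
  assume "0 \<le> i"
  then have "Finite i = initial_budget (enat (nat i))"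
    by (simp add: initial_budget_def)
  then show "Finite i \<in> range initial_budget"
    by blast
qed (auto simp: initial_budget_def split: enat.splits)

text \<open>The damage series has nonnegative terms, so it is bounded by \<open>k\<close> iff all
  partial sums are. For finite \<open>k\<close> the budget at time \<open>n\<close> is
  \<open>k\<close> minus the \<open>n\<close>-th partial sum; for infinite \<open>k\<close> both
  sides hold.\<close>

lemma total_damage_le_iff:
  assumes spend: "\<forall>n. fst (snd (configuration s k a \<omega> (Suc n))) =
     spend (fst (snd (configuration s k a \<omega> n))) (damage \<omega> n)"
  shows "total_damage \<omega> \<le> ereal_of_enat k \<longleftrightarrow>
    (\<forall>n. fst (snd (configuration s k a \<omega> n)) \<in> range initial_budget)"
proof (cases k)
  case (enat j)
  have budget: "fst (snd (configuration s k a \<omega> n)) =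
      Finite (int j - (\<Sum>i<n. of_bool (damage \<omega> i)))" for n
  proof (induction n)
    case 0
    show ?case
      by (simp add: enat initial_budget_def)
  next
    case (Suc n)
    show ?case
      unfolding spend[rule_format] Suc.IH by simp
  qed
  have "(\<Sum>i<n. of_bool (damage \<omega> i)) = ereal (real_of_int (\<Sum>i<n. of_bool (damage \<omega> i)))" for n
    by (induction n) (auto simp: one_ereal_def)
  then have partial: "(\<Sum>i<n. of_bool (damage \<omega> i)) \<le> ereal_of_enat k \<longleftrightarrow>
      fst (snd (configuration s k a \<omega> n)) \<in> range initial_budget" for n
    unfolding budget Finite_in_range_initial_budget_iff by (simp add: enat)
  show ?thesis
    unfolding partial[symmetric] total_damage_def
    by (auto intro!: suminf_bound intro: order_trans[OF suminf_upper])
next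
  case infinity
  have "fst (snd (configuration s k a \<omega> n)) = Infinite" for n
    by (induction n) (simp_all add: infinity spend[unfolded infinity] initial_budget_def del: configuration_Suc)
  then show ?thesis
    by (auto simp: infinity initial_budget_def intro!: image_eqI[of _ _ \<infinity>])
qed

section \<open>Viability as a condition on the budget\<close>

lemma viableD:
  "viable p s k a \<Longrightarrow> transition_possible p s a s' d \<Longrightarrow>
    of_bool d \<le> k \<and> (\<exists>a'. viable p s' (k - of_bool d) a')"
  by (subst (asm) viable.simps) blast

text \<open>The upward closure \<open>X\<close> of \<open>viable\<close> in the budget satisfies the
  coinduction condition: extra budget keeps damage affordable and survives the subtraction. This
  makes the least viable budget a threshold.\<close>

lemma viable_mono:
  assumes "viable p s k a" "k \<le> k'"
  shows "viable p s k' a"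
proof -
  define X where "X s k' a \<longleftrightarrow> (\<exists>k. viable p s k a \<and> k \<le> k')" for s k' a
  have "X s k' a"
    using assms by (auto simp: X_def)
  then show ?thesis
  proof (coinduction arbitrary: s a k' rule: viable.coinduct)
    case viable
    then obtain k where k: "viable p s k a" "k \<le> k'"
      by (auto simp: X_def)
    have "of_bool d \<le> k' \<and> (\<exists>a'. X s' (k' - of_bool d) a')"
      if possible: "transition_possible p s a s' d" for s' d
    proof -
      obtain a' where "of_bool d \<le> k" "viable p s' (k - of_bool d) a'"
        using viableD[OF k(1) possible] by blast
      moreover have "k - of_bool d \<le> k' - of_bool d"
        using \<open>k \<le> k'\<close> by (cases k; cases k'; cases d) (auto simp: one_enat_def)
      ultimately show ?thesis
        using \<open>k \<le> k'\<close> unfolding X_def by (blast intro: order_trans)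
    qed
    then show ?case
      by (simp split del: split_of_bool) blast
  qed
qed

section \<open>Viability and the optimal barrier\<close>

context transition_kernel
begin

lemma viable_under_iff:
  "viable_under p \<pi> s k a \<longleftrightarrow> (\<forall>n. AE \<omega> in trajectory_law p \<pi> s k a.
     fst (snd (configuration s k a \<omega> n)) \<in> range initial_budget)"
proof -
  have "AE \<omega> in trajectory_law p \<pi> s k a. total_damage \<omega> \<le> ereal_of_enat k \<longleftrightarrow>
      (\<forall>n. fst (snd (configuration s k a \<omega> n)) \<in> range initial_budget)"
    using AE_spend by eventually_elim (rule total_damage_le_iff)
  then show ?thesis
    unfolding viable_under_def AE_all_countable[symmetric] by (rule eventually_subst)
qed

text \<open>Coinduction on the configurations with nonnegative budget that the given policy reaches
  with positive probability at some time.\<close>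

lemma viable_under_imp_viable:
  assumes "viable_under p \<pi> s k a"
  shows "viable p s k a"
proof -
  let ?T = "trajectory_law p \<pi> s k a"
  interpret prob_space ?T
    by (rule prob_space_trajectory_law)
  have nonneg: "AE \<omega> in ?T. fst (snd (configuration s k a \<omega> n)) \<in> range initial_budget" for n
    using assms by (simp add: viable_under_iff)
  have *: "viable p s' k' a'"
    if "\<exists>n. \<not> (AE \<omega> in ?T. configuration s k a \<omega> n \<noteq> (s', initial_budget k', a'))" for s' k' a'
    using that
  proof (coinduction arbitrary: s' k' a' rule: viable.coinduct)
    case viable
    then obtain n
      where reachable: "\<not> (AE \<omega> in ?T. configuration s k a \<omega> n \<noteq> (s', initial_budget k', a'))"
      by blast
    have "of_bool d \<le> k' \<and> (\<exists>a''. \<exists>n. \<not> (AE \<omega> in ?T. configuration s k a \<omega> n \<noteq>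
        (s'', initial_budget (k' - of_bool d), a'')))"
      if possible: "transition_possible p s' a' s'' d" for s'' d
    proof -
      let ?b = "spend (initial_budget k') d"
      \<comment> \<open>Any action in the support of the policy serves as the successor action
        demanded by \<open>viable\<close>.\<close>
      obtain a'' where a'': "a'' \<in> set_pmf (\<pi> s'' ?b)"
        using set_pmf_not_empty[of "\<pi> s'' ?b"] by blast
      have next_reachable: "\<not> (AE \<omega> in ?T. configuration s k a \<omega> (Suc n) \<noteq> (s'', ?b, a''))"
      proof
        assume "AE \<omega> in ?T. configuration s k a \<omega> (Suc n) \<noteq> (s'', ?b, a'')"
        then have "AE \<omega> in ?T. case configuration s k a \<omega> n of (s', b, a') \<Rightarrow>
            \<forall>s1 d a1. transition_possible p s' a' s1 d \<longrightarrow> a1 \<in> set_pmf (\<pi> s1 (spend b d)) \<longrightarrow>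
              (s1, spend b d, a1) \<noteq> (s'', ?b, a'')"
          by (rule AE_trajectory_law_step_iff[THEN iffD1])
        then have "AE \<omega> in ?T. configuration s k a \<omega> n \<noteq> (s', initial_budget k', a')"
          by eventually_elim (rule notI, simp only: prod.case, use possible a'' in blast)
        with reachable show False ..
      qed
      \<comment> \<open>A negative budget here would be reached with positive probability, against
        \<open>nonneg\<close>.\<close>
      have "?b \<in> range initial_budget"
      proof (rule ccontr)
        assume "?b \<notin> range initial_budget"
        then have "AE \<omega> in ?T. configuration s k a \<omega> (Suc n) \<noteq> (s'', ?b, a'')"
          using nonneg[of "Suc n"] by (auto elim!: eventually_mono simp del: configuration_Suc)
        with next_reachable show False ..
      qed
      then have "of_bool d \<le> k'"
        by (simp only: spend_initial_budget_in_range_iff)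
      with next_reachable show ?thesis
        by (auto simp only: spend_initial_budget)
    qed
    then show ?case
      by (simp split del: split_of_bool) blast
  qed
  show ?thesis
    by (rule *) (rule exI[of _ 0], simp)
qed

text \<open>A deterministic choice of a viable action at each state and budget is already a
  stationary memory policy, and it preserves viability along every possible step.\<close>

lemma viable_imp_viable_under:
  assumes "viable p s k a"
  shows "\<exists>\<pi>. viable_under p \<pi> s k a"
proof
  \<comment> \<open>Policies see a \<open>budget\<close>, viability an \<open>enat\<close>;
    injectivity of \<open>initial_budget\<close> makes \<open>k'\<close> unique. At negative budgets
    the choice is arbitrary.\<close>
  define choice where "choice s' b = (SOME a'. \<exists>k'. b = initial_budget k' \<and> viable p s' k' a')" for s' b
  define \<pi> where "\<pi> s' b = return_pmf (choice s' b)" for s' b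
  have choice: "viable p s' k' (choice s' (initial_budget k'))" if "\<exists>a'. viable p s' k' a'" for s' k'
    using someI_ex[of "\<lambda>a'. \<exists>k''. initial_budget k' = initial_budget k'' \<and> viable p s' k'' a'"] that
    unfolding choice_def by auto
  let ?T = "trajectory_law p \<pi> s k a"
  define V where "V c \<longleftrightarrow>
    (\<exists>k'. fst (snd c) = initial_budget k' \<and> viable p (fst c) k' (snd (snd c)))" for c
  have step: "V (s'', spend b d, a'')"
    if V: "V (s', b, a')" and possible: "transition_possible p s' a' s'' d"
      and a'': "a'' \<in> set_pmf (\<pi> s'' (spend b d))" for s' b a' s'' d a''
  proof -
    obtain k' where k': "b = initial_budget k'" "viable p s' k' a'"
      using V by (auto simp: V_def)
    then have "of_bool d \<le> k'" "\<exists>a'. viable p s'' (k' - of_bool d) a'"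
      using viableD[OF _ possible] by blast+
    with choice[OF this(2)] a'' show ?thesis
      by (auto simp: k' V_def spend_initial_budget \<pi>_def)
  qed
  have step_all: "case c of (s', b, a') \<Rightarrow>
      \<forall>s'' d a''. transition_possible p s' a' s'' d \<longrightarrow> a'' \<in> set_pmf (\<pi> s'' (spend b d)) \<longrightarrow>
        V (s'', spend b d, a'')" if "V c" for c
    using that by (cases c) (simp only: prod.case, intro allI impI, rule step)
  have "AE \<omega> in ?T. V (configuration s k a \<omega> n)" for n
  proof (induction n)
    case 0
    show ?case
      using assms by (auto simp: V_def)
  next
    case (Suc n)
    then have "AE \<omega> in ?T. case configuration s k a \<omega> n of (s', b, a') \<Rightarrow>
        \<forall>s'' d a''. transition_possible p s' a' s'' d \<longrightarrow> a'' \<in> set_pmf (\<pi> s'' (spend b d)) \<longrightarrow>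
          V (s'', spend b d, a'')"
      by eventually_elim (rule step_all)
    then show ?case
      by (rule AE_trajectory_law_step_iff[THEN iffD2])
  qed
  then have "AE \<omega> in ?T. fst (snd (configuration s k a \<omega> n)) \<in> range initial_budget" for n
    by (rule eventually_mono) (auto simp: V_def)
  then show "viable_under p \<pi> s k a"
    by (simp add: viable_under_iff)
qed

text \<open>Barriers only take the values 0 and minus infinity, so the maximum runs over a finite
  set and is 0 iff some policy attains 0.\<close>

lemma opt_barrier_eq_0_iff: "opt_barrier p s k a = 0 \<longleftrightarrow> viable p s k a"
proof -
  let ?B = "range (\<lambda>\<pi>. barrier p \<pi> s k a)"
  have "opt_barrier p s k a = 0 \<longleftrightarrow> 0 \<in> ?B"
    unfolding opt_barrier_def
  proof
    assume "Max ?B = 0"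
    then show "0 \<in> ?B"
      using Max_in[OF finite_range_barrier[of s k a]] by simp
  next
    assume "0 \<in> ?B"
    then show "Max ?B = 0"
      by (rule Max_eqI[OF finite_range_barrier, rotated]) (auto simp: barrier_eq)
  qed
  also have "\<dots> \<longleftrightarrow> (\<exists>\<pi>. viable_under p \<pi> s k a)"
    by (auto simp: barrier_eq viable_under_def image_iff)
  finally show ?thesis
    using viable_under_imp_viable viable_imp_viable_under by blast
qed

text \<open>The viable budgets form an upward closed set whose least element is
  \<open>min_budget\<close>.\<close>

lemma min_budget_le_iff: "min_budget p s a \<le> k \<longleftrightarrow> viable p s k a"
  using opt_barrier_min_budget[of s a] viable_mono
  by (auto simp: opt_barrier_eq_0_iff min_budget_def intro: Least_le)

section \<open>Positive probabilities and the recursion\<close>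

lemma transition_possible_iff:
  "transition_possible p s a s' d \<longleftrightarrow> \<P>(x in p s a. fst x = s' \<and> snd (snd x) = d) > 0"
proof -
  interpret prob_space "p s a"
    by (rule prob_space_kernel)
  show ?thesis
    unfolding transition_possible_def
    by (subst prob_Collect_eq_0[symmetric])
       (use pred_outcome[where s = s and a = a and \<phi> = "\<lambda>x y. x = s' \<and> y = d"]
         in \<open>auto simp: pred_def zero_less_measure_iff\<close>)
qed

lemma trans_prob_pos_iff: "trans_prob p s a s' > 0 \<longleftrightarrow> (\<exists>d. transition_possible p s a s' d)"
proof -
  interpret prob_space "p s a"
    by (rule prob_space_kernel)
  have "trans_prob p s a s' = 0 \<longleftrightarrow> (AE x in p s a. fst x \<noteq> s')"
    unfolding trans_prob_def
    by (rule prob_Collect_eq_0)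
       (use pred_outcome[where s = s and a = a and \<phi> = "\<lambda>x y. x = s'"] in \<open>simp add: pred_def\<close>)
  also have "\<dots> \<longleftrightarrow> \<not> (\<exists>d. transition_possible p s a s' d)"
    by (subst AE_kernel_iff[where \<phi> = "\<lambda>x y. x \<noteq> s'"]) auto
  finally show ?thesis
    using measure_nonneg[of "p s a"] by (auto simp: trans_prob_def zero_less_measure_iff)
qed

lemma damage_indicator_eq: "damage_indicator p s a s' = of_bool (transition_possible p s a s' True)"
proof -
  interpret prob_space "p s a"
    by (rule prob_space_kernel)
  \<comment> \<open>A positive joint probability thus forces a positive denominator in the
    conditional probability. With denominator 0 the quotient is 0 and damage is impossible, so both
    sides agree.\<close>
  have "\<P>(x in p s a. snd (snd x) \<and> fst x = s') \<le> trans_prob p s a s'"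
    unfolding trans_prob_def
    by (rule finite_measure_mono)
       (use pred_outcome[where s = s and a = a and \<phi> = "\<lambda>x y. x = s'"] in \<open>auto simp: pred_def\<close>)
  moreover have "transition_possible p s a s' True \<longleftrightarrow> \<P>(x in p s a. snd (snd x) \<and> fst x = s') > 0"
    by (simp add: transition_possible_iff conj_commute)
  ultimately have "damage_prob p s a s' > 0 \<longleftrightarrow> transition_possible p s a s' True"
    by (auto simp: damage_prob_def cond_prob_def zero_less_divide_iff trans_prob_def not_less
          measure_nonneg dest: less_le_trans)
  then show ?thesis
    by (simp add: damage_indicator_def)
qed

text \<open>Ensures that the maximum in the recursion is over a nonempty set.\<close>

lemma ex_transition_possible: "\<exists>s' d. transition_possible p s a s' d"
proof (rule ccontr)
  interpret prob_space "p s a"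
    by (rule prob_space_kernel)
  assume "\<nexists>s' d. transition_possible p s a s' d"
  then have "AE x in p s a. False"
    by (subst AE_kernel_iff[where \<phi> = "\<lambda>_ _. False"]) blast
  then show False
    by simp
qed

text \<open>Both sides are shown to have the same upper bounds \<open>k\<close>; for the left side
  these are the viable budgets, and the rule for \<open>viable\<close> is unfolded once.\<close>

lemma min_budget_bellman:
  "min_budget p s a =
    (MAX s'\<in>{s'. trans_prob p s a s' > 0}.
       damage_indicator p s a s' + (MIN a'. min_budget p s' a'))"
proof -
  let ?m = "\<lambda>s'. MIN a'. min_budget p s' a'"
  have ne: "{s'. trans_prob p s a s' > 0} \<noteq> {}"
    using ex_transition_possible[of s a] by (auto simp: trans_prob_pos_iff)
  \<comment> \<open>Affordability together with truncated subtraction becomes a single inequality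
    with addition, valid for infinite values too.\<close>
  have le_iff: "of_bool d \<le> k \<and> (\<exists>a'. min_budget p s' a' \<le> k - of_bool d) \<longleftrightarrow> of_bool d + ?m s' \<le> k"
    for s' d k
  proof -
    have "(\<exists>a'. min_budget p s' a' \<le> k - of_bool d) \<longleftrightarrow> ?m s' \<le> k - of_bool d"
      by (subst Min_le_iff) auto
    then show ?thesis
      by (cases k; cases d; cases "?m s'") (auto simp: one_enat_def)
  qed
  have "min_budget p s a \<le> k \<longleftrightarrow>
      (MAX s'\<in>{s'. trans_prob p s a s' > 0}. damage_indicator p s a s' + ?m s') \<le> k" for k
  proof -
    have "min_budget p s a \<le> k \<longleftrightarrow>
        (\<forall>s' d. transition_possible p s a s' d \<longrightarrow> of_bool d + ?m s' \<le> k)"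
      unfolding min_budget_le_iff viable.simps[of p s k a] le_iff[symmetric] by auto
    also have "\<dots> \<longleftrightarrow> (\<forall>s'. trans_prob p s a s' > 0 \<longrightarrow> damage_indicator p s a s' + ?m s' \<le> k)"
    proof (intro iff_allI)
      fix s'
      \<comment> \<open>If both damage values are possible, the bound for damage implies the one
        without, so only the indicator counts.\<close>
      have "?m s' \<le> k" if "1 + ?m s' \<le> k"
        by (rule order_trans[OF add_increasing[OF zero_le order_refl] that])
      then show "(\<forall>d. transition_possible p s a s' d \<longrightarrow> of_bool d + ?m s' \<le> k) \<longleftrightarrow>
          (trans_prob p s a s' > 0 \<longrightarrow> damage_indicator p s a s' + ?m s' \<le> k)"
        by (auto simp: trans_prob_pos_iff damage_indicator_eq all_bool_eq ex_bool_eq)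
    qed
    also have "\<dots> \<longleftrightarrow>
        (MAX s'\<in>{s'. trans_prob p s a s' > 0}. damage_indicator p s a s' + ?m s') \<le> k"
      using ne by (subst Max_le_iff) auto
    finally show ?thesis .
  qed
  \<comment> \<open>Taking \<open>k\<close> to be each side in turn gives both inequalities.\<close>
  then show ?thesis
    by (meson order_antisym order_refl)
qed

end

theorem theorem10:
  fixes p :: "('s::finite, 'a::finite) kernel" and s :: 's and a :: 'a
  assumes "cmdp p"
  shows "min_budget p s a =
    (MAX s'\<in>{s'. trans_prob p s a s' > 0}.
       damage_indicator p s a s' + (MIN a'. min_budget p s' a'))"
proof -
  interpret cmdp p
    by (rule assms)
  show ?thesis
    by (rule min_budget_bellman)
qed

end
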